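(* Let $\Lambda=\{1,\dots,N\}$, let $X_\nu$ ($\nu\in\Lambda$) be Banach spaces, let $C_\nu\subseteq X_\nu$, $X=\prod_{\nu\in\Lambda}X_\nu$, $C=\prod_{\nu\in\Lambda}C_\nu$, and let $\Gamma=(X_\nu,K_\nu,P_\nu)_{\nu\in\Lambda}$ be a generalized game. For every $\nu\in\Lambda$ assume that: (a) $P_\nu:X\rightrightarrows X_\nu$ is a convex valued map which is mid-point continuous with respect to $X_\nu$, and $x_\nu\notin P_\nu(x)$ for every $x\in X$; (b) $K_\nu:C\rightrightarrows C_\nu$ is a closed (i.e. closed graph) lower semi-continuous map with non-empty convex values, and $K_\nu(C)=\bigcup_{x\in C}K_\nu(x)$ is relatively compact. Then the set of equilibrium points is non-empty: $\mathbb{S}(\Gamma)\neq\emptyset$.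
   Context: All Banach spaces are real. $P:A\rightrightarrows B$ denotes a set-valued map (values may be empty). Finite products carry the product norm topology. Write $X_{-\nu}=\prod_{\mu\in\Lambda\setminus\{\nu\}}X_\mu$ and $x=(x_\nu,x_{-\nu})$, so $X=X_\nu\times X_{-\nu}$. A generalized game $\Gamma=(X_\nu,K_\nu,P_\nu)_{\nu\in\Lambda}$ consists of (non-ordered) preference maps $P_\nu:X\rightrightarrows X_\nu$ and feasible strategy maps $K_\nu:C\rightrightarrows C_\nu$, where $C_\nu\subseteq X_\nu$ is the strategy set of player $\nu$. $\mathbb{S}(\Gamma)$ is the set of equilibrium points: $\bar x\in\mathbb{S}(\Gamma)$ if $\bar x\in C$ and, for every $\nu\in\Lambda$, $\bar x_\nu\in K_\nu(\bar x)$ and $P_\nu(\bar x)\cap K_\nu(\bar x)=\emptyset$. Mid-point continuity. For Banach spaces $U,Y$, a map $P:U\times Y\rightrightarrows U$ is mid-point continuous with respect to $U$ if for every $(x,y)\in U\times Y$ and every $w\in P(x,y)$ there exist $t\in[0,1)$ and open sets $V,W\subseteq U$, $O\subseteq Y$ such that $tx+(1-t)w\in V$, $x\in W$, $y\in O$, and $w'\in P(x',y')$ for all $w'\in V$, $x'\in W$, $y'\in O$. Here it is applied to $P_\nu$ with $U=X_\nu$, $Y=X_{-\nu}$.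
   Formalization: Each strategy set C_ν is additionally assumed non-empty and convex (false otherwise: C={0,1}, K swapping 0 and 1, P empty); the X_ν are closed subspaces of one Banach space, and relative compactness of K_ν(C) means compact closure in C_ν. *)

theory Defs
  imports "HOL-Analysis.Analysis"
begin

text \<open>
  A set-valued map \<open>P : A \<rightrightarrows> B\<close> is a function into sets; its domain and its codomain are given
  by the topologies (or sets) passed to the notions below.
\<close>

definition closed_graph :: "'a topology \<Rightarrow> 'b topology \<Rightarrow> ('a \<Rightarrow> 'b set) \<Rightarrow> bool" where
  "closed_graph S T F \<longleftrightarrow> closedin (prod_topology S T) {(x, y). x \<in> topspace S \<and> y \<in> F x}"

definition lower_semicontinuous :: "'a topology \<Rightarrow> 'b topology \<Rightarrow> ('a \<Rightarrow> 'b set) \<Rightarrow> bool" where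
  "lower_semicontinuous S T F \<longleftrightarrow>
     (\<forall>V. openin T V \<longrightarrow> openin S {x \<in> topspace S. F x \<inter> V \<noteq> {}})"

definition relatively_compactin :: "'a topology \<Rightarrow> 'a set \<Rightarrow> bool" where
  "relatively_compactin T A \<longleftrightarrow> A \<subseteq> topspace T \<and> compactin T (T closure_of A)"

definition midpoint_continuous ::
    "'u::real_vector topology \<Rightarrow> 'y topology \<Rightarrow> ('u \<Rightarrow> 'y \<Rightarrow> 'u set) \<Rightarrow> bool" where
  "midpoint_continuous U Y P \<longleftrightarrow>
     (\<forall>x \<in> topspace U. \<forall>y \<in> topspace Y. \<forall>w \<in> P x y.
        \<exists>(t::real) V W Q. 0 \<le> t \<and> t < 1 \<and> openin U V \<and> openin U W \<and> openin Y Q \<and>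
          t *\<^sub>R x + (1 - t) *\<^sub>R w \<in> V \<and> x \<in> W \<and> y \<in> Q \<and>
          (\<forall>w' \<in> V. \<forall>x' \<in> W. \<forall>y' \<in> Q. w' \<in> P x' y'))"

text \<open>
  A finite family of (in general different) Banach spaces is given as a family of closed linear
  subspaces of one Banach space; up to isometric isomorphism every finite family arises so, with
  the direct sum of the family as the ambient space. The product of a family \<open>A\<close> over \<open>I\<close>
  is \<^term>\<open>PiE I A\<close>, with the topology below; for finite \<open>I\<close> this is the product norm topology.
\<close>

definition banach_family :: "'i set \<Rightarrow> ('i \<Rightarrow> 'a::banach set) \<Rightarrow> bool" where
  "banach_family I X \<longleftrightarrow> (\<forall>\<nu>\<in>I. subspace (X \<nu>) \<and> closed (X \<nu>))"

definition profile_topology :: "'i set \<Rightarrow> ('i \<Rightarrow> 'a::topological_space set) \<Rightarrow> ('i \<Rightarrow> 'a) topology" where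
  "profile_topology I A = product_topology (\<lambda>\<mu>. top_of_set (A \<mu>)) I"

text \<open>
  The argument \<open>C\<close> records the strategy sets: \<open>K \<nu>\<close> is a map from \<^term>\<open>PiE I C\<close> to \<open>C \<nu>\<close>.
\<close>

definition generalized_game ::
    "'i set \<Rightarrow> ('i \<Rightarrow> 'a::banach set) \<Rightarrow> ('i \<Rightarrow> 'a set) \<Rightarrow>
     ('i \<Rightarrow> ('i \<Rightarrow> 'a) \<Rightarrow> 'a set) \<Rightarrow> ('i \<Rightarrow> ('i \<Rightarrow> 'a) \<Rightarrow> 'a set) \<Rightarrow> bool" where
  "generalized_game I X C K P \<longleftrightarrow>
     banach_family I X \<and>
     (\<forall>\<nu>\<in>I. C \<nu> \<subseteq> X \<nu> \<and>
        (\<forall>x \<in> PiE I X. P \<nu> x \<subseteq> X \<nu>) \<and>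
        (\<forall>x \<in> PiE I C. K \<nu> x \<subseteq> C \<nu>))"

definition equilibria ::
    "'i set \<Rightarrow> ('i \<Rightarrow> 'a set) \<Rightarrow> ('i \<Rightarrow> ('i \<Rightarrow> 'a) \<Rightarrow> 'a set) \<Rightarrow>
     ('i \<Rightarrow> ('i \<Rightarrow> 'a) \<Rightarrow> 'a set) \<Rightarrow> ('i \<Rightarrow> 'a) set" where
  "equilibria I C K P =
     {x \<in> PiE I C. \<forall>\<nu>\<in>I. x \<nu> \<in> K \<nu> x \<and> P \<nu> x \<inter> K \<nu> x = {}}"

text \<open>The profile \<open>(u, y)\<close> with \<open>u \<in> X \<nu>\<close> and \<open>y \<in> PiE (I - {\<nu>}) X\<close> is \<^term>\<open>y(\<nu> := u)\<close>.\<close>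

definition midpoint_continuous_wrt ::
    "'i set \<Rightarrow> ('i \<Rightarrow> 'a::real_normed_vector set) \<Rightarrow> 'i \<Rightarrow> (('i \<Rightarrow> 'a) \<Rightarrow> 'a set) \<Rightarrow> bool" where
  "midpoint_continuous_wrt I X \<nu> P \<longleftrightarrow>
     midpoint_continuous (top_of_set (X \<nu>)) (profile_topology (I - {\<nu>}) X) (\<lambda>u y. P (y(\<nu> := u)))"

end

theory Submission
  imports Defs
begin

text \<open>
  Preferences are replaced by payoffs. Let \<open>u \<nu> x w\<close> be the distance of \<open>(x, w)\<close> from the complement
  of the graph of \<open>P \<nu>\<close>. It is Lipschitz; it is quasi-concave in \<open>w\<close>, as the values of \<open>P \<nu>\<close> are
  convex (\<open>convex_infdist_complement_graph\<close>); and it vanishes at \<open>w = x \<nu>\<close>, as \<open>x \<nu>\<close> is not in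
  \<open>P \<nu> x\<close>. If \<open>w \<in> P \<nu> x\<close>, then mid-point continuity provides a point between \<open>x \<nu>\<close> and \<open>w\<close> with
  positive payoff (\<open>infdist_complement_graph_pos_at_midpoint\<close>), and this point is feasible whenever
  \<open>x \<nu>\<close> and \<open>w\<close> are, since the values of \<open>K \<nu>\<close> are convex. Hence a feasible profile \<open>x\<close> at which
  every \<open>x \<nu>\<close> maximizes \<open>u \<nu> x\<close> over \<open>K \<nu> x\<close> is an equilibrium: the maximum is \<open>0\<close>, so no feasible
  strategy is preferred.

  Such a profile exists in every game with continuous quasi-concave payoffs of this kind
  (\<open>equilibrium_exists\<close>). Closed convex hulls of feasible strategies may leave the strategy
  sets, so the fixed point argument takes place in convex hulls of finite subsets of the compact sets
  that contain the values of \<open>K\<close>. The points of a finite net are averaged with weights that single out nearly feasible and nearly optimal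
  strategies. The weights are continuous by Berge's maximum theorem
  (\<open>continuous_on_Sup_over_correspondence\<close>), so Brouwer's theorem, applied to the weights
  (\<open>fixed_point_of_continuous_weights\<close>), gives an approximate equilibrium. Compactness, the closed
  graphs and lower semi-continuity then allow the passage to the limit.
\<close>

section \<open>Products as subspaces of a function space\<close>

text \<open>
  The coordinates outside of \<open>I\<close> are fixed to \<^const>\<open>undefined\<close>, so they do not contribute to
  the topology of the full function space. This makes the metric on functions with countable domain,
  and hence sequences, available for profiles.
\<close>

lemma profile_topology_eq_top_of_set:
  fixes A :: "'i \<Rightarrow> 'a::topological_space set"
  shows "profile_topology I A = top_of_set (PiE I A)"
proof -
  let ?P = "profile_topology I A"
  have top: "topspace ?P = PiE I A"
    by (simp add: profile_topology_def)
  have "continuous_map ?P (top_of_set (PiE I A)) id"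
  proof -
    have "continuous_map ?P (product_topology (\<lambda>_. euclidean) UNIV) id"
      unfolding continuous_map_componentwise_UNIV
    proof
      fix k
      show "continuous_map ?P euclidean (\<lambda>x. id x k)"
      proof (cases "k \<in> I")
        case True
        then have "continuous_map ?P (top_of_set (A k)) (\<lambda>x. x k)"
          unfolding profile_topology_def by (rule continuous_map_product_projection)
        then show ?thesis
          by (simp add: continuous_map_in_subtopology)
      next
        case False
        then have undef: "undefined = id x k" if "x \<in> topspace ?P" for x
          using that by (auto simp: top PiE_def extensional_def)
        show ?thesis
          by (rule continuous_map_eq[where f = "\<lambda>_. undefined"]) (simp, rule undef)
      qed
    qed
    then show ?thesis
      by (simp add: continuous_map_in_subtopology top euclidean_product_topology Pi_def)
  qed
  moreover have "continuous_map (top_of_set (PiE I A)) ?P id"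
    unfolding profile_topology_def continuous_map_componentwise
    by (auto simp: PiE_iff continuous_map_in_subtopology continuous_on_subset[OF continuous_on_product_coordinates])
  ultimately have "homeomorphic_maps ?P (top_of_set (PiE I A)) id id"
    by (simp add: homeomorphic_maps_def)
  then show ?thesis
    by (simp add: homeomorphic_maps_id)
qed

lemma compact_PiE:
  fixes A :: "'i \<Rightarrow> 'a::topological_space set"
  assumes "\<And>i. i \<in> I \<Longrightarrow> compact (A i)"
  shows "compact (PiE I A)"
proof -
  have "compact_space (profile_topology I A)"
    unfolding profile_topology_def
    using assms by (simp add: compact_space_product_topology compact_space_subtopology)
  then show ?thesis
    unfolding profile_topology_eq_top_of_set
    using compact_space_subtopology compactin_subspace compactin_euclidean_iff
    by (metis subset_UNIV topspace_euclidean)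
qed

lemma tendsto_coordinatewise_iff:
  fixes f :: "'b \<Rightarrow> 'i \<Rightarrow> 'a::topological_space"
  shows "(f \<longlongrightarrow> l) F \<longleftrightarrow> (\<forall>i. ((\<lambda>n. f n i) \<longlongrightarrow> l i) F)"
  using limitin_componentwise[of "\<lambda>_. euclidean" UNIV f l F]
  by (simp add: euclidean_product_topology flip: limitin_canonical_iff)

section \<open>Brouwer fixed points\<close>

text \<open>
  Brouwer's theorem for cubes whose dimension is a number and not a type. Kuhn's lemma gives, for
  every grid size, a cell on which every coordinate of \<open>f x - x\<close> takes a value \<open>\<ge> 0\<close> and a value
  \<open>\<le> 0\<close>; at a limit point of these cells all coordinates vanish.
\<close>

lemma brouwer_cube_of_functions:
  fixes f :: "(nat \<Rightarrow> real) \<Rightarrow> nat \<Rightarrow> real" and n :: nat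
  defines "Q \<equiv> PiE {..<n} (\<lambda>_. {0..1::real})"
  assumes cont: "\<And>i. i < n \<Longrightarrow> continuous_on Q (\<lambda>x. f x i)"
    and maps: "\<And>x i. x \<in> Q \<Longrightarrow> i < n \<Longrightarrow> f x i \<in> {0..1}"
  obtains z where "z \<in> Q" "\<And>i. i < n \<Longrightarrow> f z i = z i"
proof -
  have "compact Q"
    unfolding Q_def by (rule compact_PiE) simp
  define g :: "nat \<Rightarrow> (nat \<Rightarrow> nat) \<Rightarrow> nat \<Rightarrow> real"
    where "g p q = (\<lambda>i\<in>{..<n}. real (q i) / real (Suc p))" for p q
  have gQ: "g p q \<in> Q" if "\<forall>i<n. q i \<le> Suc p" for p q
    using that by (auto simp: g_def Q_def)
  \<comment> \<open>The condition on \<open>q i\<close> decides ties on the upper face, where Kuhn's lemma wants label 1.\<close>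
  define label :: "nat \<Rightarrow> (nat \<Rightarrow> nat) \<Rightarrow> nat \<Rightarrow> nat"
    where "label p q i = (if g p q i \<le> f (g p q) i \<and> q i \<noteq> Suc p then 0 else 1)" for p q i
  have label1: "f (g p q) i \<le> g p q i" if "label p q i \<noteq> 0" "\<forall>i<n. q i \<le> Suc p" "i < n" for p q i
    using that maps[OF gQ[OF that(2)] \<open>i < n\<close>]
    by (auto simp: label_def g_def split: if_splits)
  have label0: "g p q i \<le> f (g p q) i" if "label p q i = 0" for p q i
    using that by (auto simp: label_def split: if_splits)
  have "\<exists>q. (\<forall>i<n. q i < Suc p) \<and> (\<forall>i<n. \<exists>r s. (\<forall>j<n. q j \<le> r j \<and> r j \<le> q j + 1) \<and>
      (\<forall>j<n. q j \<le> s j \<and> s j \<le> q j + 1) \<and> label p r i \<noteq> label p s i)" for p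
  proof (rule kuhn_lemma[of "Suc p" n "label p"])
    show "\<forall>x. (\<forall>i<n. x i \<le> Suc p) \<longrightarrow> (\<forall>i<n. x i = 0 \<longrightarrow> label p x i = 0)"
      using maps[OF gQ] by (fastforce simp: label_def g_def)
    fix q
    assume "\<forall>i<n. q i < Suc p" "\<forall>i<n. \<exists>r s. (\<forall>j<n. q j \<le> r j \<and> r j \<le> q j + 1) \<and>
      (\<forall>j<n. q j \<le> s j \<and> s j \<le> q j + 1) \<and> label p r i \<noteq> label p s i"
    then show ?thesis
      by blast
  qed (auto simp: label_def)
  then obtain q where "\<And>p. (\<forall>i<n. q p i < Suc p) \<and> (\<forall>i<n. \<exists>r s. (\<forall>j<n. q p j \<le> r j \<and> r j \<le> q p j + 1) \<and>
      (\<forall>j<n. q p j \<le> s j \<and> s j \<le> q p j + 1) \<and> label p r i \<noteq> label p s i)"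
    by (elim choice[OF allI, THEN exE]) blast
  then have q: "\<And>p i. i < n \<Longrightarrow> q p i < Suc p"
    and rs: "\<And>p i. i < n \<Longrightarrow> \<exists>r s. (\<forall>j<n. q p j \<le> r j \<and> r j \<le> q p j + 1) \<and>
      (\<forall>j<n. q p j \<le> s j \<and> s j \<le> q p j + 1) \<and> label p r i \<noteq> label p s i"
    by blast+
  have inQ: "g p (q p) \<in> Q" for p
    using q by (intro gQ) (simp add: less_imp_le)
  have "\<forall>p. g p (q p) \<in> Q"
    using inQ by blast
  then obtain z \<phi> where z: "z \<in> Q" "strict_mono \<phi>" and lim: "((\<lambda>p. g p (q p)) \<circ> \<phi>) \<longlonglongrightarrow> z"
    by (rule seq_compactE[OF compact_imp_seq_compact[OF \<open>compact Q\<close>]])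
  \<comment> \<open>All vertices of the \<open>p\<close>-th cell converge to the same point, as the cells have side
    \<open>1 / Suc p\<close>.\<close>
  have close: "(\<lambda>p. g (\<phi> p) (t (\<phi> p))) \<longlonglongrightarrow> z"
    if t: "\<And>p j. j < n \<Longrightarrow> q p j \<le> t p j \<and> t p j \<le> q p j + 1" for t
    unfolding tendsto_coordinatewise_iff
  proof
    fix j
    have lim_j: "(\<lambda>p. g (\<phi> p) (q (\<phi> p)) j) \<longlonglongrightarrow> z j"
      using lim by (simp add: tendsto_coordinatewise_iff o_def)
    show "(\<lambda>p. g (\<phi> p) (t (\<phi> p)) j) \<longlonglongrightarrow> z j"
    proof (cases "j < n")
      case True
      have "(\<lambda>p. 1 / real (Suc (\<phi> p))) \<longlonglongrightarrow> 0"
        using LIMSEQ_subseq_LIMSEQ[OF LIMSEQ_inverse_real_of_nat \<open>strict_mono \<phi>\<close>]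
        by (simp add: o_def inverse_eq_divide)
      with lim_j have up: "(\<lambda>p. g (\<phi> p) (q (\<phi> p)) j + 1 / real (Suc (\<phi> p))) \<longlonglongrightarrow> z j"
        using tendsto_add by fastforce
      have "real (q p j) / real (Suc p) \<le> real (t p j) / real (Suc p) \<and>
          real (t p j) / real (Suc p) \<le> real (q p j) / real (Suc p) + 1 / real (Suc p)" for p
        using t[OF True, of p] unfolding add_divide_distrib[symmetric]
        by (intro conjI divide_right_mono) linarith+
      then show ?thesis
        using True by (intro tendsto_sandwich[OF _ _ lim_j up] always_eventually) (auto simp: g_def)
    next
      case False
      then show ?thesis
        using lim_j by (simp add: g_def)
    qed
  qed
  have "f z i = z i" if i: "i < n" for i
  proof -
    have "\<exists>r s. (\<forall>j<n. q p j \<le> r j \<and> r j \<le> q p j + 1) \<and>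
        (\<forall>j<n. q p j \<le> s j \<and> s j \<le> q p j + 1) \<and> label p r i = 0 \<and> label p s i \<noteq> 0" for p
    proof -
      obtain r s where "\<forall>j<n. q p j \<le> r j \<and> r j \<le> q p j + 1"
        "\<forall>j<n. q p j \<le> s j \<and> s j \<le> q p j + 1" "label p r i \<noteq> label p s i"
        using rs[OF i] by blast
      moreover from this have "label p r i = 0 \<and> label p s i \<noteq> 0 \<or> label p s i = 0 \<and> label p r i \<noteq> 0"
        by (simp add: label_def split: if_splits)
      ultimately show ?thesis
        by blast
    qed
    then obtain r where "\<And>p. \<exists>s. (\<forall>j<n. q p j \<le> r p j \<and> r p j \<le> q p j + 1) \<and>
        (\<forall>j<n. q p j \<le> s j \<and> s j \<le> q p j + 1) \<and> label p (r p) i = 0 \<and> label p s i \<noteq> 0"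
      by (elim choice[OF allI, THEN exE]) blast
    then obtain s where
      "\<And>p. (\<forall>j<n. q p j \<le> r p j \<and> r p j \<le> q p j + 1) \<and>
        (\<forall>j<n. q p j \<le> s p j \<and> s p j \<le> q p j + 1) \<and> label p (r p) i = 0 \<and> label p (s p) i \<noteq> 0"
      by (elim choice[OF allI, THEN exE]) blast
    then have r: "\<And>p j. j < n \<Longrightarrow> q p j \<le> r p j \<and> r p j \<le> q p j + 1"
      and s: "\<And>p j. j < n \<Longrightarrow> q p j \<le> s p j \<and> s p j \<le> q p j + 1"
      and lab: "\<And>p. label p (r p) i = 0" "\<And>p. label p (s p) i \<noteq> 0"
      by blast+
    have rQ: "\<forall>j<n. r p j \<le> Suc p" and sQ: "\<forall>j<n. s p j \<le> Suc p" for p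
      using r[of _ p] s[of _ p] q[of _ p] by fastforce+
    have f_lim: "(\<lambda>p. f (h p) i) \<longlonglongrightarrow> f z i" if "h \<longlonglongrightarrow> z" "\<And>p. h p \<in> Q" for h
      using cont[OF i] that \<open>z \<in> Q\<close> by (auto simp: continuous_on_sequentially o_def)
    have coord: "(\<lambda>p. h p i) \<longlonglongrightarrow> z i" if "h \<longlonglongrightarrow> z" for h
      using that by (simp add: tendsto_coordinatewise_iff)
    have "z i \<le> f z i"
    proof (rule LIMSEQ_le)
      show "(\<lambda>p. g (\<phi> p) (r (\<phi> p)) i) \<longlonglongrightarrow> z i"
        using coord[OF close[of r]] r by auto
      show "(\<lambda>p. f (g (\<phi> p) (r (\<phi> p))) i) \<longlonglongrightarrow> f z i"
        using f_lim[OF close[of r]] r gQ[OF rQ] by auto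
      show "\<exists>N. \<forall>p\<ge>N. g (\<phi> p) (r (\<phi> p)) i \<le> f (g (\<phi> p) (r (\<phi> p))) i"
        using label0[OF lab(1)] by blast
    qed
    moreover have "f z i \<le> z i"
    proof (rule LIMSEQ_le)
      show "(\<lambda>p. g (\<phi> p) (s (\<phi> p)) i) \<longlonglongrightarrow> z i"
        using coord[OF close[of s]] s by auto
      show "(\<lambda>p. f (g (\<phi> p) (s (\<phi> p))) i) \<longlonglongrightarrow> f z i"
        using f_lim[OF close[of s]] s gQ[OF sQ] by auto
      show "\<exists>N. \<forall>p\<ge>N. f (g (\<phi> p) (s (\<phi> p))) i \<le> g (\<phi> p) (s (\<phi> p)) i"
        using lab(2) label1 sQ i by blast
    qed
    ultimately show ?thesis
      by simp
  qed
  with z show thesis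
    using that by blast
qed

text \<open>
  The system says that \<open>x\<close> is a fixed point of a continuous map whose \<open>i\<close>-th component is a convex
  combination of the finite set \<open>E i\<close>. Such a map factors through the finite-dimensional cube of
  weights, to which Brouwer's theorem applies.
\<close>

lemma fixed_point_of_continuous_weights:
  fixes C E :: "'i \<Rightarrow> 'a::real_normed_vector set" and g :: "'i \<Rightarrow> 'a \<Rightarrow> ('i \<Rightarrow> 'a) \<Rightarrow> real"
  assumes fin: "finite I" "\<And>i. i \<in> I \<Longrightarrow> finite (E i)"
    and E: "\<And>i. i \<in> I \<Longrightarrow> E i \<noteq> {}" "\<And>i. i \<in> I \<Longrightarrow> E i \<subseteq> C i"
    and C: "\<And>i. i \<in> I \<Longrightarrow> convex (C i)"
    and cont: "\<And>i e. i \<in> I \<Longrightarrow> e \<in> E i \<Longrightarrow> continuous_on (PiE I C) (g i e)"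
    and nonneg: "\<And>i e x. i \<in> I \<Longrightarrow> e \<in> E i \<Longrightarrow> x \<in> PiE I C \<Longrightarrow> 0 \<le> g i e x"
    and sum_one: "\<And>i x. i \<in> I \<Longrightarrow> x \<in> PiE I C \<Longrightarrow> (\<Sum>e\<in>E i. g i e x) = 1"
  obtains x where "x \<in> PiE I C" "\<And>i. i \<in> I \<Longrightarrow> x i = (\<Sum>e\<in>E i. g i e x *\<^sub>R e)"
proof -
  define J where "J = Sigma I E"
  define n where "n = card J"
  define Q where "Q = PiE {..<n} (\<lambda>_. {0..1::real})"
  have "finite J"
    using fin by (auto simp: J_def)
  then obtain b where b: "bij_betw b {..<n} J"
    using ex_bij_betw_nat_finite[of J] unfolding n_def atLeast0LessThan by blast
  define idx where "idx = inv_into {..<n} b"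
  have idx: "idx (i, e) < n" "b (idx (i, e)) = (i, e)" if "i \<in> I" "e \<in> E i" for i e
    using b that bij_betw_inv_into_right[OF b, of "(i, e)"]
      bij_betwE[OF bij_betw_inv_into[OF b]] by (auto simp: idx_def J_def)
  have bJ: "fst (b k) \<in> I" "snd (b k) \<in> E (fst (b k))" if "k < n" for k
    using bspec[OF bij_betwE[OF b], of k] that by (cases "b k"; simp add: J_def)+
  define d where "d i = (SOME e. e \<in> E i)" for i
  have d: "d i \<in> E i" if "i \<in> I" for i
    using E(1)[OF that] by (simp add: d_def some_in_eq)
  define \<sigma> where "\<sigma> l i = (\<Sum>e\<in>E i. l (idx (i, e)))" for l :: "nat \<Rightarrow> real" and i
  \<comment> \<open>Arbitrary points of the cube are turned into convex weights: missing mass goes to \<open>d i\<close>,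
    excess mass is scaled away. On weights of total mass one this is the identity.\<close>
  define a where "a l i e = (l (idx (i, e)) + (if e = d i then max 0 (1 - \<sigma> l i) else 0)) / max 1 (\<sigma> l i)"
    for l i e
  define \<phi> where "\<phi> l = (\<lambda>i\<in>I. \<Sum>e\<in>E i. a l i e *\<^sub>R e)" for l
  have a_sum: "(\<Sum>e\<in>E i. a l i e) = 1" if "i \<in> I" for l i
  proof -
    have "(\<Sum>e\<in>E i. a l i e) = (\<sigma> l i + max 0 (1 - \<sigma> l i)) / max 1 (\<sigma> l i)"
      using fin(2)[OF that] d[OF that]
      by (simp add: a_def \<sigma>_def sum.distrib sum.delta flip: sum_divide_distrib)
    then show ?thesis
      by (simp add: max_def)
  qed
  have a_nonneg: "0 \<le> a l i e" if "l \<in> Q" "i \<in> I" "e \<in> E i" for l i e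
    using that idx[of i e] by (auto simp: a_def Q_def PiE_def Pi_def intro!: divide_nonneg_nonneg add_nonneg_nonneg)
  have \<phi>_in: "\<phi> l \<in> PiE I C" if "l \<in> Q" for l
  proof
    fix i assume "i \<in> I"
    then have "(\<Sum>e\<in>E i. a l i e *\<^sub>R e) \<in> C i"
      using fin E C a_sum a_nonneg[OF that] by (intro convex_sum) auto
    then show "\<phi> l i \<in> C i"
      using \<open>i \<in> I\<close> by (simp add: \<phi>_def)
  qed (simp add: \<phi>_def)
  have coord_cont: "continuous_on Q (\<lambda>l. l k)" for k
    by (rule continuous_on_subset[OF continuous_on_product_coordinates]) simp
  have \<sigma>_cont: "continuous_on Q (\<lambda>l. \<sigma> l i)" for i
    unfolding \<sigma>_def by (rule continuous_on_sum) (rule coord_cont)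
  have nz: "max 1 (\<sigma> l i) \<noteq> 0" for l i
    by linarith
  have if_cont: "continuous_on Q (\<lambda>l. if e = d i then max 0 (1 - \<sigma> l i) else 0)" for i e
    by (cases "e = d i") (simp_all add: continuous_on_max continuous_on_diff \<sigma>_cont)
  have a_cont: "continuous_on Q (\<lambda>l. a l i e)" for i e
    unfolding a_def
    by (rule continuous_on_divide continuous_on_add coord_cont if_cont continuous_on_max
        continuous_on_const \<sigma>_cont ballI nz)+
  have \<phi>_cont: "continuous_on Q \<phi>"
  proof (rule continuous_on_coordinatewise_then_product)
    fix i
    show "continuous_on Q (\<lambda>l. \<phi> l i)"
      by (cases "i \<in> I") (auto simp: \<phi>_def intro!: continuous_intros a_cont)
  qed
  define f where "f l k = g (fst (b k)) (snd (b k)) (\<phi> l)" for l k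
  have "continuous_on Q (\<lambda>l. f l k)" if "k < n" for k
    unfolding f_def using \<phi>_in bJ[OF that]
    by (intro continuous_on_compose2[OF cont \<phi>_cont]) auto
  moreover have "f l k \<in> {0..1}" if "l \<in> Q" "k < n" for l k
  proof -
    note ie = bJ[OF \<open>k < n\<close>] and x = \<phi>_in[OF \<open>l \<in> Q\<close>]
    have "g (fst (b k)) (snd (b k)) (\<phi> l) \<le> (\<Sum>e\<in>E (fst (b k)). g (fst (b k)) e (\<phi> l))"
      using ie x nonneg fin by (intro member_le_sum) auto
    then show ?thesis
      using sum_one[OF ie(1) x] nonneg[OF ie x] by (simp add: f_def)
  qed
  ultimately obtain z where z: "z \<in> Q" and fix_z: "\<And>k. k < n \<Longrightarrow> f z k = z k"
    using brouwer_cube_of_functions[of n f] unfolding Q_def by blast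
  have z_eq: "z (idx (i, e)) = g i e (\<phi> z)" if "i \<in> I" "e \<in> E i" for i e
    using fix_z[of "idx (i, e)"] idx[OF that] by (simp add: f_def)
  have \<sigma>_z: "\<sigma> z i = 1" if "i \<in> I" for i
    using sum_one[OF that \<phi>_in[OF z]] z_eq[OF that] by (simp add: \<sigma>_def)
  have "\<phi> z i = (\<Sum>e\<in>E i. g i e (\<phi> z) *\<^sub>R e)" if "i \<in> I" for i
    using that z_eq \<sigma>_z by (auto simp: \<phi>_def a_def intro!: sum.cong)
  with \<phi>_in[OF z] show thesis
    using that by blast
qed

section \<open>Maxima over a set-valued constraint\<close>

text \<open>
  Lower semi-continuity, stated for open conditions that involve the point as well as its image.
\<close>

lemma openin_lower_preimage:
  fixes S :: "'b::topological_space set" and T :: "'c::topological_space set"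
  assumes lsc: "lower_semicontinuous (top_of_set S) (top_of_set T) K"
    and W: "openin (top_of_set (S \<times> T)) W"
  shows "openin (top_of_set S) {x \<in> S. \<exists>w\<in>K x. (x, w) \<in> W}"
proof (subst openin_subopen, safe)
  fix x w assume "x \<in> S" "w \<in> K x" "(x, w) \<in> W"
  have "openin (prod_topology (top_of_set S) (top_of_set T)) W"
    unfolding prod_topology_subtopology_eu by (rule W)
  from this[unfolded openin_prod_topology_alt, rule_format, OF \<open>(x, w) \<in> W\<close>]
  obtain A B where AB: "openin (top_of_set S) A" "openin (top_of_set T) B"
      "x \<in> A" "w \<in> B" "A \<times> B \<subseteq> W"
    by (elim exE conjE)
  define U where "U = A \<inter> {x \<in> S. K x \<inter> B \<noteq> {}}"
  have "openin (top_of_set S) U"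
    using AB lsc unfolding U_def lower_semicontinuous_def by (intro openin_Int) auto
  moreover have "x \<in> U"
    using AB \<open>x \<in> S\<close> \<open>w \<in> K x\<close> by (auto simp: U_def)
  moreover have "U \<subseteq> {x \<in> S. \<exists>w\<in>K x. (x, w) \<in> W}"
    using AB by (auto simp: U_def)
  ultimately show "\<exists>U. openin (top_of_set S) U \<and> x \<in> U \<and> U \<subseteq> {x \<in> S. \<exists>w\<in>K x. (x, w) \<in> W}"
    by blast
qed

text \<open>
  Upper semi-continuity of a closed map into a compact set: the projection along a compact factor is
  closed.
\<close>

lemma closedin_upper_preimage:
  fixes S :: "'b::topological_space set" and T D :: "'c::topological_space set"
  assumes graph: "closed_graph (top_of_set S) (top_of_set T) K"
    and D: "compact D" "D \<subseteq> T" "\<And>x. x \<in> S \<Longrightarrow> K x \<subseteq> D"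
    and Z: "closedin (top_of_set (S \<times> D)) Z"
  shows "closedin (top_of_set S) {x \<in> S. \<exists>w\<in>K x. (x, w) \<in> Z}"
proof -
  let ?G = "{(x, y). x \<in> S \<and> y \<in> K x}"
  have "closedin (top_of_set (S \<times> T)) ?G"
    using graph by (simp add: closed_graph_def prod_topology_subtopology_eu)
  then have "closedin (top_of_set (S \<times> D)) ?G"
    using D by (elim closedin_subset_trans) auto
  with Z have "closedin (prod_topology (top_of_set S) (top_of_set D)) (?G \<inter> Z)"
    by (simp add: prod_topology_subtopology_eu closedin_Int)
  moreover have "closed_map (prod_topology (top_of_set S) (top_of_set D)) (top_of_set S) fst"
    using D by (intro Abstract_Topological_Spaces.closed_map_fst)
      (simp add: compact_space_subtopology)
  ultimately have "closedin (top_of_set S) (fst ` (?G \<inter> Z))"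
    by (simp add: closed_map_def)
  moreover have "fst ` (?G \<inter> Z) = {x \<in> S. \<exists>w\<in>K x. (x, w) \<in> Z}"
    by force
  ultimately show ?thesis
    by simp
qed

lemma compact_values:
  fixes S :: "'b::topological_space set" and T D :: "'c::t2_space set"
  assumes graph: "closed_graph (top_of_set S) (top_of_set T) K"
    and D: "compact D" "D \<subseteq> T" and x: "x \<in> S" "K x \<subseteq> D"
  shows "compact (K x)"
proof -
  have "closedin (top_of_set (S \<times> T)) {(x, y). x \<in> S \<and> y \<in> K x}"
    using graph by (simp add: closed_graph_def prod_topology_subtopology_eu)
  then have "closedin (top_of_set D) (D \<inter> Pair x -` {(x, y). x \<in> S \<and> y \<in> K x})"
    using D x by (intro continuous_closedin_preimage_gen[where T = "S \<times> T"])
     (auto intro!: continuous_intros)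
  moreover have "D \<inter> Pair x -` {(x, y). x \<in> S \<and> y \<in> K x} = K x"
    using x by auto
  ultimately show ?thesis
    using D closedin_compact_eq by metis
qed

text \<open>
  Berge's maximum theorem. The value exceeds \<open>c\<close> iff some feasible \<open>w\<close> satisfies the open condition
  \<open>c < u x w\<close>, and, as the maximum is attained, it is at least \<open>c\<close> iff some feasible \<open>w\<close> satisfies the
  closed condition \<open>c \<le> u x w\<close>; the two preimage lemmas apply.
\<close>

lemma continuous_on_Sup_over_correspondence:
  fixes S :: "'b::topological_space set" and T D :: "'c::t2_space set" and u :: "'b \<Rightarrow> 'c \<Rightarrow> real"
  assumes graph: "closed_graph (top_of_set S) (top_of_set T) K"
    and lsc: "lower_semicontinuous (top_of_set S) (top_of_set T) K"
    and D: "compact D" "D \<subseteq> T" "\<And>x. x \<in> S \<Longrightarrow> K x \<subseteq> D"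
    and ne: "\<And>x. x \<in> S \<Longrightarrow> K x \<noteq> {}"
    and u: "continuous_on (S \<times> T) (\<lambda>(x, w). u x w)"
  shows "continuous_on S (\<lambda>x. SUP w\<in>K x. u x w)"
    and "\<And>x w. x \<in> S \<Longrightarrow> w \<in> K x \<Longrightarrow> u x w \<le> (SUP w\<in>K x. u x w)"
    and "\<And>x. x \<in> S \<Longrightarrow> \<exists>w\<in>K x. (SUP w\<in>K x. u x w) = u x w"
proof -
  define M where "M x = (SUP w\<in>K x. u x w)" for x
  have max: "\<exists>w\<in>K x. u x w = M x \<and> (\<forall>v\<in>K x. u x v \<le> M x)" if "x \<in> S" for x
  proof -
    have "compact (K x)"
      using graph D that by (intro compact_values[of S T K D]) auto
    moreover have "continuous_on (K x) (u x)"
      using D that continuous_on_compose2[OF u, of "K x" "\<lambda>w. (x, w)"]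
      by (force intro!: continuous_intros)
    ultimately obtain w where w: "w \<in> K x" "\<And>v. v \<in> K x \<Longrightarrow> u x v \<le> u x w"
      using continuous_attains_sup[of "K x" "u x"] ne[of x] \<open>x \<in> S\<close> by blast
    then have "M x = u x w"
      unfolding M_def by (intro cSup_eq_maximum) auto
    with w show ?thesis
      by auto
  qed
  then show "\<And>x w. x \<in> S \<Longrightarrow> w \<in> K x \<Longrightarrow> u x w \<le> (SUP w\<in>K x. u x w)"
    and "\<And>x. x \<in> S \<Longrightarrow> \<exists>w\<in>K x. (SUP w\<in>K x. u x w) = u x w"
    unfolding M_def by metis+
  have "openin (top_of_set S) {x \<in> S. c < M x}" for c
  proof -
    have "openin (top_of_set (S \<times> T)) ((S \<times> T) \<inter> (\<lambda>(x, w). u x w) -` {c<..})"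
      using u by (rule continuous_openin_preimage_gen) simp
    from openin_lower_preimage[OF lsc this]
    have "openin (top_of_set S) {x \<in> S. \<exists>w\<in>K x. w \<in> T \<and> c < u x w}"
      by (simp add: conj_commute cong: conj_cong)
    also have "{x \<in> S. \<exists>w\<in>K x. w \<in> T \<and> c < u x w} = {x \<in> S. c < M x}"
    proof (intro Collect_cong conj_cong refl)
      fix x assume "x \<in> S"
      from max[OF this] D(2) D(3)[OF this] show "(\<exists>w\<in>K x. w \<in> T \<and> c < u x w) \<longleftrightarrow> c < M x"
        by (metis less_le_trans subsetD)
    qed
    finally show ?thesis .
  qed
  moreover have "closedin (top_of_set S) {x \<in> S. c \<le> M x}" for c
  proof -
    have "closedin (top_of_set (S \<times> D)) ((S \<times> D) \<inter> (\<lambda>(x, w). u x w) -` {c..})"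
      using D by (intro continuous_closedin_preimage continuous_on_subset[OF u]) auto
    from closedin_upper_preimage[OF graph D this]
    have "closedin (top_of_set S) {x \<in> S. \<exists>w\<in>K x. w \<in> D \<and> c \<le> u x w}"
      by (simp add: conj_commute cong: conj_cong)
    also have "{x \<in> S. \<exists>w\<in>K x. w \<in> D \<and> c \<le> u x w} = {x \<in> S. c \<le> M x}"
    proof (intro Collect_cong conj_cong refl)
      fix x assume "x \<in> S"
      from max[OF this] D(2) D(3)[OF this] show "(\<exists>w\<in>K x. w \<in> D \<and> c \<le> u x w) \<longleftrightarrow> c \<le> M x"
        by (metis order_trans subsetD)
    qed
    finally show ?thesis .
  qed
  then have "openin (top_of_set S) {x \<in> S. M x < c}" for c
  proof -
    have "openin (top_of_set S) (S - {x \<in> S. c \<le> M x})"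
      using \<open>\<And>c. closedin _ _\<close> by (simp add: closedin_def)
    moreover have "S - {x \<in> S. c \<le> M x} = {x \<in> S. M x < c}"
      by auto
    ultimately show ?thesis
      by simp
  qed
  ultimately have "continuous_map (top_of_set S) euclidean M"
    by (simp add: continuous_map_upper_lower_semicontinuous_lt)
  then show "continuous_on S (\<lambda>x. SUP w\<in>K x. u x w)"
    by (simp add: M_def[abs_def])
qed

section \<open>Equilibria for quasi-concave payoffs\<close>

lemma convex_neighbourhood:
  fixes A :: "'a::real_normed_vector set"
  assumes "convex A"
  shows "convex {w. \<exists>v\<in>A. dist w v < \<epsilon>}"
proof -
  have "{w. \<exists>v\<in>A. dist w v < \<epsilon>} = (\<Union>v\<in>A. \<Union>y\<in>ball 0 \<epsilon>. {v + y})" (is "?L = ?R")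
  proof
    show "?L \<subseteq> ?R"
    proof
      fix w assume "w \<in> ?L"
      then obtain v where "v \<in> A" "dist w v < \<epsilon>"
        by blast
      then have "v \<in> A" "w - v \<in> ball 0 \<epsilon>" "w = v + (w - v)"
        by (simp_all add: dist_norm norm_minus_commute)
      then show "w \<in> ?R"
        by blast
    qed
    show "?R \<subseteq> ?L"
      by (force simp: dist_norm)
  qed
  then show ?thesis
    using convex_sums[OF assms convex_ball] by simp
qed

text \<open>
  Games with numerical payoffs \<open>u i x w\<close>, the value for player \<open>i\<close> of strategy \<open>w\<close> against the profile
  \<open>x\<close>. The value may depend on the coordinate \<open>x i\<close> too, which is what preferences that are not
  ordered require. The compact set \<open>D i\<close> contains all feasible strategies. The Lipschitz bound makes
  finite nets of \<open>D i\<close> good enough uniformly in \<open>x\<close>. The players are countable so that profiles form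
  a metric space.
\<close>

locale quasi_concave_game =
  fixes I :: "'i::countable set" and C D :: "'i \<Rightarrow> 'a::real_normed_vector set"
    and K :: "'i \<Rightarrow> ('i \<Rightarrow> 'a) \<Rightarrow> 'a set" and u :: "'i \<Rightarrow> ('i \<Rightarrow> 'a) \<Rightarrow> 'a \<Rightarrow> real"
  assumes finite_players: "finite I"
    and C_ne: "\<And>i. i \<in> I \<Longrightarrow> C i \<noteq> {}"
    and C_convex: "\<And>i. i \<in> I \<Longrightarrow> convex (C i)"
    and K_graph: "\<And>i. i \<in> I \<Longrightarrow> closed_graph (top_of_set (PiE I C)) (top_of_set (C i)) (K i)"
    and K_lsc: "\<And>i. i \<in> I \<Longrightarrow> lower_semicontinuous (top_of_set (PiE I C)) (top_of_set (C i)) (K i)"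
    and K_ne: "\<And>i x. i \<in> I \<Longrightarrow> x \<in> PiE I C \<Longrightarrow> K i x \<noteq> {}"
    and K_convex: "\<And>i x. i \<in> I \<Longrightarrow> x \<in> PiE I C \<Longrightarrow> convex (K i x)"
    and D_compact: "\<And>i. i \<in> I \<Longrightarrow> compact (D i)"
    and D_sub: "\<And>i. i \<in> I \<Longrightarrow> D i \<subseteq> C i"
    and K_sub: "\<And>i x. i \<in> I \<Longrightarrow> x \<in> PiE I C \<Longrightarrow> K i x \<subseteq> D i"
    and u_cont: "\<And>i. i \<in> I \<Longrightarrow> continuous_on (PiE I C \<times> C i) (\<lambda>(x, w). u i x w)"
    and u_quasi_concave: "\<And>i x c. i \<in> I \<Longrightarrow> x \<in> PiE I C \<Longrightarrow> convex {w \<in> C i. c < u i x w}"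
    and u_lipschitz: "\<And>i x v w. i \<in> I \<Longrightarrow> x \<in> PiE I C \<Longrightarrow> v \<in> C i \<Longrightarrow> w \<in> C i \<Longrightarrow>
      u i x v \<le> u i x w + dist v w"
begin

lemma Sup_over_K:
  fixes v :: "('i \<Rightarrow> 'a) \<Rightarrow> 'a \<Rightarrow> real"
  assumes i: "i \<in> I" and v: "continuous_on (PiE I C \<times> C i) (\<lambda>(x, w). v x w)"
  shows "continuous_on (PiE I C) (\<lambda>x. SUP w\<in>K i x. v x w)"
    and "\<And>x w. x \<in> PiE I C \<Longrightarrow> w \<in> K i x \<Longrightarrow> v x w \<le> (SUP w\<in>K i x. v x w)"
    and "\<And>x. x \<in> PiE I C \<Longrightarrow> \<exists>w\<in>K i x. (SUP w\<in>K i x. v x w) = v x w"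
proof -
  note Sup = continuous_on_Sup_over_correspondence[where S = "PiE I C" and u = v,
      OF K_graph[OF i] K_lsc[OF i] D_compact[OF i] D_sub[OF i] _ _ v]
  show "continuous_on (PiE I C) (\<lambda>x. SUP w\<in>K i x. v x w)"
    by (rule Sup(1)) (simp_all add: K_sub K_ne i)
  show "v x w \<le> (SUP w\<in>K i x. v x w)" if "x \<in> PiE I C" "w \<in> K i x" for x w
    by (rule Sup(2)) (simp_all add: K_sub K_ne i that)
  show "\<exists>w\<in>K i x. (SUP w\<in>K i x. v x w) = v x w" if "x \<in> PiE I C" for x
    by (rule Sup(3)) (simp_all add: K_sub K_ne i that)
qed

text \<open>
  Take a finite \<open>\<epsilon>\<close>-net of every \<open>D i\<close> and average its points with continuous weights that are
  positive only at points which are \<open>\<epsilon>\<close>-feasible and \<open>\<epsilon>\<close>-optimal. Some net point qualifies, namely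
  one near an optimal strategy. The \<open>\<epsilon>\<close>-feasible and \<open>\<epsilon>\<close>-optimal strategies form a convex set, so
  the average qualifies too, and a fixed point of the averaging map is the profile sought.
\<close>

lemma approximate_equilibrium:
  assumes "0 < \<epsilon>"
  obtains x where "x \<in> PiE I C"
    "\<And>i. i \<in> I \<Longrightarrow> \<exists>v\<in>K i x. dist (x i) v < \<epsilon>"
    "\<And>i w. i \<in> I \<Longrightarrow> w \<in> K i x \<Longrightarrow> u i x w < u i x (x i) + \<epsilon>"
proof -
  let ?S = "PiE I C"
  obtain x0 where x0: "x0 \<in> ?S"
    using C_ne by (metis PiE_eq_empty_iff all_not_in_conv)
  have "\<forall>i\<in>I. \<exists>E. finite E \<and> E \<subseteq> D i \<and> D i \<subseteq> (\<Union>e\<in>E. ball e \<epsilon>)"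
    using seq_compact_imp_totally_bounded[OF compact_imp_seq_compact[OF D_compact]] \<open>0 < \<epsilon>\<close> by blast
  from bchoice[OF this] obtain E
    where "\<forall>i\<in>I. finite (E i) \<and> E i \<subseteq> D i \<and> D i \<subseteq> (\<Union>e\<in>E i. ball e \<epsilon>)" ..
  then have E: "finite (E i)" "E i \<subseteq> D i" "D i \<subseteq> (\<Union>e\<in>E i. ball e \<epsilon>)" if "i \<in> I" for i
    using that by simp_all
  have EC: "e \<in> C i" if "i \<in> I" "e \<in> E i" for i e
    using that E(2) D_sub by blast
  define M where "M i x = (SUP w\<in>K i x. u i x w)" for i x
  define h where "h i e x = (SUP w\<in>K i x. - dist e w)" for i e x
  note M = Sup_over_K[OF _ u_cont, folded M_def]
  have dist_cont: "continuous_on (?S \<times> C i) (\<lambda>(x, w). - dist e w)" for i e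
    by (simp add: case_prod_unfold continuous_on_minus continuous_on_dist continuous_on_snd)
  note h = Sup_over_K[OF _ dist_cont, folded h_def]
  \<comment> \<open>A point \<open>e\<close> of the net gets weight exactly when it is nearly feasible (first factor) and
    nearly optimal (second factor) at \<open>x\<close>.\<close>
  define a where "a i e x = max 0 (\<epsilon> + h i e x) * max 0 (u i x e - M i x + \<epsilon>)" for i e x
  have a_nonneg: "0 \<le> a i e x" for i e x
    by (simp add: a_def)
  have a_cont: "continuous_on ?S (a i e)" if "i \<in> I" "e \<in> E i" for i e
  proof -
    have "continuous_on ?S (\<lambda>x. u i x e)"
      using continuous_on_compose2[OF u_cont[OF \<open>i \<in> I\<close>]
          continuous_on_Pair[OF continuous_on_id continuous_on_const[of _ e]], of ?S] EC[OF that]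
      by (simp add: image_subset_iff)
    then show ?thesis
      unfolding a_def
      by (intro continuous_on_mult continuous_on_max continuous_on_add continuous_on_diff continuous_on_const
          M(1) h(1) \<open>i \<in> I\<close>)
  qed
  have near_max: "(\<exists>v\<in>K i x. dist e v < \<epsilon>) \<and> M i x - \<epsilon> < u i x e"
    if ix: "i \<in> I" "x \<in> ?S" and pos: "0 < a i e x" for i e x
  proof -
    have bounds: "- \<epsilon> < h i e x" "M i x - \<epsilon> < u i x e"
      using pos by (auto simp: a_def zero_less_mult_iff max_def split: if_splits)
    obtain v where "v \<in> K i x" "h i e x = - dist e v"
      using h(3)[OF ix] by blast
    with bounds show ?thesis
      by auto
  qed
  have ex_pos: "\<exists>e\<in>E i. 0 < a i e x" if ix: "i \<in> I" "x \<in> ?S" for i x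
  proof -
    obtain w where w: "w \<in> K i x" "M i x = u i x w"
      using M(3)[OF ix(1) ix] by blast
    then have "w \<in> D i"
      using K_sub ix by blast
    then obtain e where e: "e \<in> E i" "dist e w < \<epsilon>"
      using E(3)[OF \<open>i \<in> I\<close>] by auto
    have "- dist e w \<le> h i e x"
      using h(2)[OF ix w(1)] .
    moreover have "u i x w \<le> u i x e + dist w e"
      using u_lipschitz[OF ix] \<open>w \<in> D i\<close> D_sub EC e ix by blast
    ultimately have "0 < a i e x"
      using e w by (auto simp: a_def dist_commute intro!: mult_pos_pos)
    with e show ?thesis
      by blast
  qed
  define s where "s i x = (\<Sum>e\<in>E i. a i e x)" for i x
  have s_pos: "0 < s i x" if ix: "i \<in> I" "x \<in> ?S" for i x
  proof -
    obtain e where "e \<in> E i" "0 < a i e x"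
      using ex_pos[OF ix] by blast
    then show ?thesis
      unfolding s_def using E(1)[OF \<open>i \<in> I\<close>] a_nonneg by (intro sum_pos2[of _ e]) auto
  qed
  have s_cont: "continuous_on ?S (s i)" if "i \<in> I" for i
    unfolding s_def by (intro continuous_on_sum a_cont that)
  obtain x where x: "x \<in> ?S" "\<And>i. i \<in> I \<Longrightarrow> x i = (\<Sum>e\<in>E i. (a i e x / s i x) *\<^sub>R e)"
  proof (rule fixed_point_of_continuous_weights[of I E C "\<lambda>i e x. a i e x / s i x"])
    fix i assume "i \<in> I"
    show "E i \<noteq> {}"
      using ex_pos[OF \<open>i \<in> I\<close> x0] by blast
    show "continuous_on ?S (\<lambda>x. a i e x / s i x)" if "e \<in> E i" for e
      using s_pos[OF \<open>i \<in> I\<close>] by (intro continuous_on_divide a_cont s_cont \<open>i \<in> I\<close> that) force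
    show "0 \<le> a i e x / s i x" if "x \<in> ?S" for e x
      using s_pos[OF \<open>i \<in> I\<close> that] a_nonneg by (simp add: less_imp_le)
    show "(\<Sum>e\<in>E i. a i e x / s i x) = 1" if "x \<in> ?S" for x
      using s_pos[OF \<open>i \<in> I\<close> that] by (simp add: s_def flip: sum_divide_distrib)
  qed (use finite_players E(1) EC C_convex in auto)
  have main: "(\<exists>v\<in>K i x. dist (x i) v < \<epsilon>) \<and> M i x - \<epsilon> < u i x (x i)" if i: "i \<in> I" for i
  proof -
    \<comment> \<open>Points without weight need not be nearly feasible or optimal, so they are removed before the
      convexity of \<open>?G\<close> is used.\<close>
    let ?G = "{w \<in> C i. M i x - \<epsilon> < u i x w} \<inter> {w. \<exists>v\<in>K i x. dist w v < \<epsilon>}"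
    let ?E' = "{e \<in> E i. 0 < a i e x}"
    have zero: "a i e x = 0" if "e \<in> E i - ?E'" for e
      using that a_nonneg[of i e x] by auto
    have "x i = (\<Sum>e\<in>?E'. (a i e x / s i x) *\<^sub>R e)"
      unfolding x(2)[OF i] using E(1)[OF i] zero by (intro sum.mono_neutral_right) auto
    moreover have "(\<Sum>e\<in>?E'. (a i e x / s i x) *\<^sub>R e) \<in> ?G"
    proof (rule convex_sum)
      show "convex ?G"
        using u_quasi_concave[OF i x(1)] convex_neighbourhood[OF K_convex[OF i x(1)]] by (rule convex_Int)
      have "(\<Sum>e\<in>?E'. a i e x) = s i x"
        unfolding s_def using E(1)[OF i] zero by (intro sum.mono_neutral_left) auto
      then show "(\<Sum>e\<in>?E'. a i e x / s i x) = 1"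
        using s_pos[OF i x(1)] by (simp flip: sum_divide_distrib)
      show "e \<in> ?G" if "e \<in> ?E'" for e
        using that near_max[OF i x(1)] EC[OF i] by blast
    qed (use E(1)[OF i] a_nonneg s_pos[OF i x(1)] in \<open>auto simp: less_imp_le\<close>)
    ultimately show ?thesis
      by auto
  qed
  have "u i x w < u i x (x i) + \<epsilon>" if "i \<in> I" "w \<in> K i x" for i w
    using main[OF that(1)] M(2)[OF that(1) that(1) x(1) that(2)] by linarith
  then show thesis
    using that x(1) main by blast
qed

text \<open>
  Strategies of an \<open>\<epsilon>\<close>-equilibrium lie near the compact sets \<open>D i\<close>, so a subsequence converges as
  \<open>\<epsilon> \<rightarrow> 0\<close>. The closed graph makes the limit feasible, and lower semi-continuity shows that no
  feasible strategy does better in the limit.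
\<close>

theorem equilibrium_exists:
  "\<exists>x \<in> PiE I C. \<forall>i\<in>I. x i \<in> K i x \<and> (\<forall>w\<in>K i x. u i x w \<le> u i x (x i))"
proof -
  let ?S = "PiE I C"
  define P where "P n x \<longleftrightarrow> x \<in> ?S \<and> (\<forall>i\<in>I. \<exists>v\<in>K i x. dist (x i) v < 1 / real (Suc n)) \<and>
      (\<forall>i\<in>I. \<forall>w\<in>K i x. u i x w < u i x (x i) + 1 / real (Suc n))" for n x
  have "\<exists>x. P n x" for n
    unfolding P_def by (rule approximate_equilibrium[of "1 / real (Suc n)"]) (simp, blast)
  then have "\<forall>n. \<exists>x. P n x" ..
  from choice[OF this] obtain X where PX: "\<forall>n. P n (X n)" ..
  then have X: "\<And>n. X n \<in> ?S"
      and X_near: "\<And>n i. i \<in> I \<Longrightarrow> \<exists>v\<in>K i (X n). dist (X n i) v < 1 / real (Suc n)"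
      and X_max: "\<And>n i w. i \<in> I \<Longrightarrow> w \<in> K i (X n) \<Longrightarrow> u i (X n) w < u i (X n) (X n i) + 1 / real (Suc n)"
    unfolding P_def by blast+
  define Y where "Y n = (\<lambda>i\<in>I. SOME v. v \<in> K i (X n) \<and> dist (X n i) v < 1 / real (Suc n))" for n
  have Y: "Y n i \<in> K i (X n) \<and> dist (X n i) (Y n i) < 1 / real (Suc n)" if "i \<in> I" for n i
    using someI_ex[of "\<lambda>v. v \<in> K i (X n) \<and> dist (X n i) v < 1 / real (Suc n)"] X_near[OF that, of n] that
    by (simp add: Y_def Bex_def)
  have "Y n \<in> PiE I D" for n
  proof
    show "Y n i \<in> D i" if "i \<in> I" for i
      using Y[OF that] K_sub[OF that X] by blast
  qed (simp add: Y_def)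
  then have "\<forall>n. Y n \<in> PiE I D"
    by blast
  moreover have "seq_compact (PiE I D)"
    using D_compact by (intro compact_imp_seq_compact compact_PiE)
  ultimately obtain y \<phi> where y: "y \<in> PiE I D" and \<phi>: "strict_mono \<phi>" and Y_lim: "(Y \<circ> \<phi>) \<longlonglongrightarrow> y"
    by (elim seq_compactE)
  have yS: "y \<in> ?S"
    using y D_sub by (auto simp: PiE_iff)
  have inv_lim: "(\<lambda>n. 1 / real (Suc (\<phi> n))) \<longlonglongrightarrow> 0"
    using LIMSEQ_subseq_LIMSEQ[OF LIMSEQ_inverse_real_of_nat \<phi>] by (simp add: o_def inverse_eq_divide)
  have Y_lim_i: "(\<lambda>n. Y (\<phi> n) i) \<longlonglongrightarrow> y i" for i
    using Y_lim by (simp add: tendsto_coordinatewise_iff o_def)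
  have X_lim_i: "(\<lambda>n. X (\<phi> n) i) \<longlonglongrightarrow> y i" for i
  proof (cases "i \<in> I")
    case True
    have "(\<lambda>n. norm (X (\<phi> n) i - Y (\<phi> n) i)) \<longlonglongrightarrow> 0"
      using Y[OF True] by (intro tendsto_sandwich[OF _ _ tendsto_const inv_lim] always_eventually)
        (simp_all add: less_imp_le flip: dist_norm)
    then have "(\<lambda>n. Y (\<phi> n) i + (X (\<phi> n) i - Y (\<phi> n) i)) \<longlonglongrightarrow> y i + 0"
      by (rule tendsto_add[OF Y_lim_i tendsto_norm_zero_cancel])
    then show ?thesis
      by simp
  next
    case False
    then have "X (\<phi> n) i = y i" for n
      using X yS by (simp add: PiE_iff extensional_def)
    then show ?thesis
      by simp
  qed
  then have X_lim: "(\<lambda>n. X (\<phi> n)) \<longlonglongrightarrow> y"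
    by (simp add: tendsto_coordinatewise_iff)
  have feasible: "y i \<in> K i y" if i: "i \<in> I" for i
  proof -
    have "closedin (top_of_set (?S \<times> C i)) {(x, w). x \<in> ?S \<and> w \<in> K i x}"
      using K_graph[OF i] by (simp add: closed_graph_def prod_topology_subtopology_eu)
    then obtain T where T: "closed T" "{(x, w). x \<in> ?S \<and> w \<in> K i x} = (?S \<times> C i) \<inter> T"
      by (auto simp: closedin_closed)
    have "(X (\<phi> n), Y (\<phi> n) i) \<in> T" for n
      using T(2) X Y[OF i] by blast
    moreover have "(\<lambda>n. (X (\<phi> n), Y (\<phi> n) i)) \<longlonglongrightarrow> (y, y i)"
      using X_lim Y_lim_i by (intro tendsto_Pair)
    ultimately have "(y, y i) \<in> T"
      using closed_sequentially[OF T(1), of "\<lambda>n. (X (\<phi> n), Y (\<phi> n) i)"] by simp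
    moreover have "(y, y i) \<in> ?S \<times> C i"
      using yS i by auto
    ultimately show ?thesis
      using T(2) by blast
  qed
  have "u i y w \<le> u i y (y i)" if i: "i \<in> I" and w: "w \<in> K i y" for i w
  proof (rule field_le_epsilon)
    fix e :: real assume "0 < e"
    have wC: "w \<in> C i"
      using w K_sub[OF i yS] D_sub[OF i] by blast
    have u_lim: "(\<lambda>n. u i (X (\<phi> n)) (g n)) \<longlonglongrightarrow> u i y z"
      if "g \<longlonglongrightarrow> z" "\<And>n. g n \<in> C i" "z \<in> C i" for g z
    proof -
      have "(\<lambda>n. (X (\<phi> n), g n)) \<longlonglongrightarrow> (y, z)"
        using X_lim that by (intro tendsto_Pair)
      then show ?thesis
        using continuous_on_tendsto_compose[OF u_cont[OF i], of "\<lambda>n. (X (\<phi> n), g n)" "(y, z)"] X yS that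
        by simp
    qed
    \<comment> \<open>By lower semi-continuity the competitor \<open>w\<close> is within \<open>e\<close> of strategies that are feasible
      along the sequence; the Lipschitz bound pays for the move.\<close>
    have "openin (top_of_set (C i)) (C i \<inter> ball w e)"
      by (simp add: openin_open_Int)
    then have "openin (top_of_set ?S) {x \<in> topspace (top_of_set ?S). K i x \<inter> (C i \<inter> ball w e) \<noteq> {}}"
      using K_lsc[OF i] unfolding lower_semicontinuous_def by blast
    then obtain T where T: "open T" "{x \<in> ?S. K i x \<inter> (C i \<inter> ball w e) \<noteq> {}} = ?S \<inter> T"
      by (auto simp: openin_open)
    have "y \<in> ?S \<inter> T"
      unfolding T(2)[symmetric] using yS w wC \<open>0 < e\<close> by auto
    then have "\<forall>\<^sub>F n in sequentially. X (\<phi> n) \<in> T"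
      using X_lim T(1) by (auto simp: tendsto_def)
    then have le: "\<forall>\<^sub>F n in sequentially. u i (X (\<phi> n)) w \<le> u i (X (\<phi> n)) (X (\<phi> n) i) + 1 / real (Suc (\<phi> n)) + e"
    proof eventually_elim
      case (elim n)
      then have "X (\<phi> n) \<in> {x \<in> ?S. K i x \<inter> (C i \<inter> ball w e) \<noteq> {}}"
        using X unfolding T(2) by blast
      then obtain v where v: "v \<in> K i (X (\<phi> n))" "v \<in> C i" "dist w v < e"
        by auto
      have "u i (X (\<phi> n)) v < u i (X (\<phi> n)) (X (\<phi> n) i) + 1 / real (Suc (\<phi> n))"
        using X_max i v by blast
      moreover have "u i (X (\<phi> n)) w \<le> u i (X (\<phi> n)) v + dist w v"
        using u_lipschitz[OF i X] wC v by blast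
      ultimately show ?case
        using v by linarith
    qed
    have left: "(\<lambda>n. u i (X (\<phi> n)) w) \<longlonglongrightarrow> u i y w"
      using wC by (intro u_lim) auto
    have "(\<lambda>n. u i (X (\<phi> n)) (X (\<phi> n) i)) \<longlonglongrightarrow> u i y (y i)"
      using X yS i by (intro u_lim X_lim_i) auto
    then have right: "(\<lambda>n. u i (X (\<phi> n)) (X (\<phi> n) i) + 1 / real (Suc (\<phi> n)) + e)
        \<longlonglongrightarrow> u i y (y i) + 0 + e"
      by (intro tendsto_add inv_lim tendsto_const)
    have "u i y w \<le> u i y (y i) + 0 + e"
      by (rule tendsto_le[OF sequentially_bot right left le])
    then show "u i y w \<le> u i y (y i) + e"
      by simp
  qed
  with yS feasible show ?thesis
    by blast
qed

end

section \<open>The distance to the complement of the graph as payoff\<close>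

text \<open>
  The distance to the complement of the graph of \<open>P\<close> is quasi-concave in the second variable: if the
  graph contains the \<open>r\<close>-balls about \<open>(x, v)\<close> and \<open>(x, w)\<close>, then it contains the \<open>r\<close>-ball about
  \<open>(x, m)\<close> for every \<open>m\<close> between \<open>v\<close> and \<open>w\<close>, because its sections are convex.
\<close>

lemma convex_infdist_complement_graph:
  fixes P :: "'b::metric_space \<Rightarrow> 'a::real_normed_vector set"
  assumes Y: "subspace Y" and P: "\<And>x. x \<in> S \<Longrightarrow> convex (P x)" and W: "convex W" "W \<subseteq> Y"
  shows "convex {w \<in> W. c < infdist (x, w) {(x, w). x \<in> S \<and> w \<in> Y \<and> w \<notin> P x}}"
proof (cases "{(x, w). x \<in> S \<and> w \<in> Y \<and> w \<notin> P x} = {}")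
  case True
  show ?thesis
    unfolding True by (cases "c < 0") (auto simp: infdist_def W)
next
  case False
  let ?Z = "{(x, w). x \<in> S \<and> w \<in> Y \<and> w \<notin> P x}"
  show ?thesis
  proof (rule convexI)
    fix v w and s t :: real
    assume v: "v \<in> {w \<in> W. c < infdist (x, w) ?Z}" and w: "w \<in> {w \<in> W. c < infdist (x, w) ?Z}"
      and st: "0 \<le> s" "0 \<le> t" "s + t = 1"
    define m where "m = s *\<^sub>R v + t *\<^sub>R w"
    have mW: "m \<in> W"
      using W(1) v w st unfolding m_def by (intro convexD) auto
    have "min (infdist (x, v) ?Z) (infdist (x, w) ?Z) \<le> dist (x, m) z" if "z \<in> ?Z" for z
    proof -
      obtain x' w' where z: "z = (x', w')" "x' \<in> S" "w' \<in> Y" "w' \<notin> P x'"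
        using \<open>z \<in> ?Z\<close> by auto
      \<comment> \<open>The witness \<open>z\<close> is shifted so that it has the same distance from \<open>(x, v)\<close> or \<open>(x, w)\<close>
        as \<open>z\<close> has from \<open>(x, m)\<close>.\<close>
      define d where "d = w' - m"
      have same: "dist (x, a) (x', a + d) = dist (x, m) z" for a
        by (simp add: z(1) dist_Pair_Pair d_def dist_norm norm_minus_commute)
      have Y_d: "v + d \<in> Y" "w + d \<in> Y"
        using Y v w W(2) mW z(3) unfolding d_def by (auto intro!: subspace_add subspace_diff)
      have "s *\<^sub>R (v + d) + t *\<^sub>R (w + d) = m + (s + t) *\<^sub>R d"
        unfolding m_def by (simp add: algebra_simps)
      then have "s *\<^sub>R (v + d) + t *\<^sub>R (w + d) = w'"
        using st by (simp add: d_def)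
      then have "v + d \<notin> P x' \<or> w + d \<notin> P x'"
        using convexD[OF P[OF z(2)] _ _ st] z(4) by metis
      then show ?thesis
      proof
        assume "v + d \<notin> P x'"
        then have "infdist (x, v) ?Z \<le> dist (x, v) (x', v + d)"
          using z(2) Y_d by (intro infdist_le) simp
        then show ?thesis
          using same by simp
      next
        assume "w + d \<notin> P x'"
        then have "infdist (x, w) ?Z \<le> dist (x, w) (x', w + d)"
          using z(2) Y_d by (intro infdist_le) simp
        then show ?thesis
          using same by simp
      qed
    qed
    then have "min (infdist (x, v) ?Z) (infdist (x, w) ?Z) \<le> infdist (x, m) ?Z"
      unfolding infdist_notempty[OF False] by (intro cINF_greatest False)
    then show "s *\<^sub>R v + t *\<^sub>R w \<in> {w \<in> W. c < infdist (x, w) ?Z}"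
      using v w mW unfolding m_def by auto
  qed
qed

text \<open>
  Mid-point continuity places a pair \<open>(x, t *\<^sub>R x \<nu> + (1 - t) *\<^sub>R w)\<close> in the interior of the graph of
  \<open>P\<close>, relative to \<open>PiE I X \<times> X \<nu>\<close>; interior points have positive distance from the complement.
\<close>

lemma infdist_complement_graph_pos_at_midpoint:
  fixes X :: "'i::countable \<Rightarrow> 'a::real_normed_vector set"
  assumes mid: "midpoint_continuous_wrt I X \<nu> P" and \<nu>: "\<nu> \<in> I" and x: "x \<in> PiE I X"
    and w: "w \<in> P x"
    and Z: "Z = {(x, w). x \<in> PiE I X \<and> w \<in> X \<nu> \<and> w \<notin> P x}" and ne: "Z \<noteq> {}"
  obtains t where "0 \<le> t" "t < 1" "0 < infdist (x, t *\<^sub>R x \<nu> + (1 - t) *\<^sub>R w) Z"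
proof -
  define r where "r x = x(\<nu> := undefined)" for x :: "'i \<Rightarrow> 'a"
  let ?S = "PiE I X"
  have r: "r y \<in> PiE (I - {\<nu>}) X" "(r y)(\<nu> := y \<nu>) = y" if "y \<in> ?S" for y
    using that by (auto simp: r_def PiE_iff extensional_def)
  have "x \<nu> \<in> X \<nu>"
    using x \<nu> by auto
  have rx: "r x \<in> topspace (profile_topology (I - {\<nu>}) X)" "w \<in> P ((r x)(\<nu> := x \<nu>))"
    using r[OF x] w by (simp_all add: profile_topology_eq_top_of_set)
  have "\<exists>(t::real) V W Q. 0 \<le> t \<and> t < 1 \<and> openin (top_of_set (X \<nu>)) V \<and> openin (top_of_set (X \<nu>)) W \<and>
      openin (profile_topology (I - {\<nu>}) X) Q \<and> t *\<^sub>R x \<nu> + (1 - t) *\<^sub>R w \<in> V \<and> x \<nu> \<in> W \<and> r x \<in> Q \<and>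
      (\<forall>w'\<in>V. \<forall>x'\<in>W. \<forall>y'\<in>Q. w' \<in> P (y'(\<nu> := x')))"
    using mid[unfolded midpoint_continuous_wrt_def midpoint_continuous_def, rule_format, OF _ rx] \<open>x \<nu> \<in> X \<nu>\<close>
    by simp
  then obtain t :: real and V W Q where t: "0 \<le> t" "t < 1"
    and V: "openin (top_of_set (X \<nu>)) V" "t *\<^sub>R x \<nu> + (1 - t) *\<^sub>R w \<in> V"
    and W: "openin (top_of_set (X \<nu>)) W" "x \<nu> \<in> W"
    and Q: "openin (top_of_set (PiE (I - {\<nu>}) X)) Q" "r x \<in> Q"
    and VWQ: "\<forall>w'\<in>V. \<forall>x'\<in>W. \<forall>y'\<in>Q. w' \<in> P (y'(\<nu> := x'))"
    unfolding profile_topology_eq_top_of_set by (elim exE conjE)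
  define m where "m = t *\<^sub>R x \<nu> + (1 - t) *\<^sub>R w"
  let ?A = "?S \<times> X \<nu>"
  define N where "N = (?A \<inter> snd -` V) \<inter> (?A \<inter> (\<lambda>p. fst p \<nu>) -` W) \<inter> (?A \<inter> (\<lambda>p. r (fst p)) -` Q)"
  have coord: "continuous_on ?A (\<lambda>p. fst p k)" for k
    by (rule continuous_on_product_then_coordinatewise) (rule continuous_on_fst[OF continuous_on_id])
  have "continuous_on ?A (\<lambda>p. r (fst p))"
  proof (rule continuous_on_coordinatewise_then_product)
    show "continuous_on ?A (\<lambda>p. r (fst p) k)" for k
      by (cases "k = \<nu>") (simp_all add: r_def coord)
  qed
  then have N_Q: "openin (top_of_set ?A) (?A \<inter> (\<lambda>p. r (fst p)) -` Q)"
    by (rule continuous_openin_preimage[OF _ _ Q(1)]) (rule Pi_I, rule r(1), simp add: mem_Times_iff)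
  have N_W: "openin (top_of_set ?A) (?A \<inter> (\<lambda>p. fst p \<nu>) -` W)"
    by (rule continuous_openin_preimage[OF coord _ W(1)]) (use \<nu> in auto)
  have N_V: "openin (top_of_set ?A) (?A \<inter> snd -` V)"
    by (rule continuous_openin_preimage[OF continuous_on_snd[OF continuous_on_id] _ V(1)]) auto
  have "openin (top_of_set ?A) N"
    unfolding N_def by (rule openin_Int[OF openin_Int[OF N_V N_W] N_Q])
  then obtain T where T: "open T" "N = ?A \<inter> T"
    by (auto simp: openin_open)
  have "(x, m) \<in> N"
    using x V(2) W(2) Q(2) subsetD[OF openin_imp_subset[OF V(1)] V(2)] by (simp add: N_def m_def)
  then have "(x, m) \<in> T"
    using T by blast
  moreover have "Z \<inter> T = {}"
  proof -
    have "w' \<in> P x'" if "(x', w') \<in> N" for x' w'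
    proof -
      have "w' \<in> V" "x' \<nu> \<in> W" "r x' \<in> Q" "x' \<in> ?S"
        using that by (auto simp: N_def)
      with VWQ have "w' \<in> P ((r x')(\<nu> := x' \<nu>))"
        by blast
      then show ?thesis
        using r(2)[OF \<open>x' \<in> ?S\<close>] by simp
    qed
    then show ?thesis
      using T(2) unfolding Z by blast
  qed
  ultimately have "(x, m) \<notin> closure Z"
    using T(1) open_Int_closure_eq_empty[of T Z] by blast
  then have "infdist (x, m) Z \<noteq> 0"
    using in_closure_iff_infdist_zero[OF ne] by blast
  then have "0 < infdist (x, m) Z"
    using infdist_nonneg[of "(x, m)" Z] by linarith
  with t show thesis
    using that unfolding m_def by blast
qed

section \<open>Equilibria for mid-point continuous preferences\<close>

theorem theorem5p4:
  fixes N :: nat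
    and X C :: "nat \<Rightarrow> 'a::banach set"
    and K P :: "nat \<Rightarrow> (nat \<Rightarrow> 'a) \<Rightarrow> 'a set"
  defines "\<Lambda> \<equiv> {1..N}"
  assumes game: "generalized_game \<Lambda> X C K P"
    and C_nonempty: "\<And>\<nu>. \<nu> \<in> \<Lambda> \<Longrightarrow> C \<nu> \<noteq> {}"
    and C_convex: "\<And>\<nu>. \<nu> \<in> \<Lambda> \<Longrightarrow> convex (C \<nu>)"
    and P_convex: "\<And>\<nu> x. \<nu> \<in> \<Lambda> \<Longrightarrow> x \<in> PiE \<Lambda> X \<Longrightarrow> convex (P \<nu> x)"
    and P_midpoint: "\<And>\<nu>. \<nu> \<in> \<Lambda> \<Longrightarrow> midpoint_continuous_wrt \<Lambda> X \<nu> (P \<nu>)"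
    and P_irrefl: "\<And>\<nu> x. \<nu> \<in> \<Lambda> \<Longrightarrow> x \<in> PiE \<Lambda> X \<Longrightarrow> x \<nu> \<notin> P \<nu> x"
    and K_closed: "\<And>\<nu>. \<nu> \<in> \<Lambda> \<Longrightarrow>
          closed_graph (profile_topology \<Lambda> C) (top_of_set (C \<nu>)) (K \<nu>)"
    and K_lsc: "\<And>\<nu>. \<nu> \<in> \<Lambda> \<Longrightarrow>
          lower_semicontinuous (profile_topology \<Lambda> C) (top_of_set (C \<nu>)) (K \<nu>)"
    and K_nonempty: "\<And>\<nu> x. \<nu> \<in> \<Lambda> \<Longrightarrow> x \<in> PiE \<Lambda> C \<Longrightarrow> K \<nu> x \<noteq> {}"
    and K_convex: "\<And>\<nu> x. \<nu> \<in> \<Lambda> \<Longrightarrow> x \<in> PiE \<Lambda> C \<Longrightarrow> convex (K \<nu> x)"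
    and K_compact: "\<And>\<nu>. \<nu> \<in> \<Lambda> \<Longrightarrow>
          relatively_compactin (top_of_set (C \<nu>)) (\<Union>x \<in> PiE \<Lambda> C. K \<nu> x)"
  shows "equilibria \<Lambda> C K P \<noteq> {}"
proof -
  define Z where "Z \<nu> = {(x, w). x \<in> PiE \<Lambda> X \<and> w \<in> X \<nu> \<and> w \<notin> P \<nu> x}" for \<nu>
  define u where "u \<nu> x w = infdist (x, w) (Z \<nu>)" for \<nu> x w
  define D where "D \<nu> = top_of_set (C \<nu>) closure_of (\<Union>x\<in>PiE \<Lambda> C. K \<nu> x)" for \<nu>
  have X: "subspace (X \<nu>)" and CX: "C \<nu> \<subseteq> X \<nu>" if "\<nu> \<in> \<Lambda>" for \<nu>
    using game that by (simp_all add: generalized_game_def banach_family_def)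
  have sub: "x \<in> PiE \<Lambda> X" if "x \<in> PiE \<Lambda> C" for x
    using that CX by (auto simp: PiE_iff)
  have diag: "(x, x \<nu>) \<in> Z \<nu>" if "\<nu> \<in> \<Lambda>" "x \<in> PiE \<Lambda> X" for x \<nu>
    using P_irrefl[OF that] that by (auto simp: Z_def)
  interpret quasi_concave_game \<Lambda> C D K u
  proof
    show "finite \<Lambda>"
      by (simp add: \<Lambda>_def)
    fix \<nu> assume \<nu>: "\<nu> \<in> \<Lambda>"
    show "C \<nu> \<noteq> {}" "convex (C \<nu>)"
      using C_nonempty C_convex \<nu> by auto
    show "closed_graph (top_of_set (PiE \<Lambda> C)) (top_of_set (C \<nu>)) (K \<nu>)"
      "lower_semicontinuous (top_of_set (PiE \<Lambda> C)) (top_of_set (C \<nu>)) (K \<nu>)"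
      using K_closed[OF \<nu>] K_lsc[OF \<nu>] by (simp_all only: profile_topology_eq_top_of_set)
    have rc: "(\<Union>x\<in>PiE \<Lambda> C. K \<nu> x) \<subseteq> C \<nu>" "compactin (top_of_set (C \<nu>)) (D \<nu>)"
      using K_compact[OF \<nu>] by (simp_all add: relatively_compactin_def D_def)
    show "compact (D \<nu>)" "D \<nu> \<subseteq> C \<nu>"
      using rc(2) by (simp_all add: compactin_subtopology)
    show "continuous_on (PiE \<Lambda> C \<times> C \<nu>) (\<lambda>(x, w). u \<nu> x w)"
      unfolding u_def case_prod_unfold prod.collapse by (intro continuous_on_infdist continuous_on_id)
    fix x assume x: "x \<in> PiE \<Lambda> C"
    show "K \<nu> x \<noteq> {}" "convex (K \<nu> x)"
      using K_nonempty K_convex \<nu> x by auto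
    show "K \<nu> x \<subseteq> D \<nu>"
      using x rc(1) closure_of_subset[of "\<Union>x\<in>PiE \<Lambda> C. K \<nu> x" "top_of_set (C \<nu>)"] by (auto simp: D_def)
    show "convex {w \<in> C \<nu>. c < u \<nu> x w}" for c
      unfolding u_def Z_def
      by (rule convex_infdist_complement_graph[OF X[OF \<nu>] P_convex[OF \<nu>] C_convex[OF \<nu>] CX[OF \<nu>]])
    show "u \<nu> x v \<le> u \<nu> x w + dist v w" for v w
      using infdist_triangle[of "(x, v)" "Z \<nu>" "(x, w)"] by (simp add: u_def dist_Pair_Pair)
  qed
  obtain x where x: "x \<in> PiE \<Lambda> C" and feasible: "\<And>\<nu>. \<nu> \<in> \<Lambda> \<Longrightarrow> x \<nu> \<in> K \<nu> x"
    and max: "\<And>\<nu> w. \<nu> \<in> \<Lambda> \<Longrightarrow> w \<in> K \<nu> x \<Longrightarrow> u \<nu> x w \<le> u \<nu> x (x \<nu>)"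
    using equilibrium_exists by blast
  have "w \<notin> K \<nu> x" if \<nu>: "\<nu> \<in> \<Lambda>" and w: "w \<in> P \<nu> x" for \<nu> w
  proof
    assume wK: "w \<in> K \<nu> x"
    have xX: "x \<in> PiE \<Lambda> X"
      using sub x by blast
    have "Z \<nu> \<noteq> {}"
      using diag[OF \<nu> xX] by blast
    then obtain t where t: "0 \<le> t" "t < 1" and pos: "0 < u \<nu> x (t *\<^sub>R x \<nu> + (1 - t) *\<^sub>R w)"
      unfolding u_def
      using infdist_complement_graph_pos_at_midpoint[OF P_midpoint[OF \<nu>] \<nu> xX w Z_def[of \<nu>]] by blast
    \<comment> \<open>The mid-point is feasible because both \<open>x \<nu>\<close> and \<open>w\<close> are, so it cannot have positive payoff.\<close>
    have "t *\<^sub>R x \<nu> + (1 - t) *\<^sub>R w \<in> K \<nu> x"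
      using K_convex[OF \<nu> x] feasible[OF \<nu>] wK t by (intro convexD) auto
    from max[OF \<nu> this] have "u \<nu> x (t *\<^sub>R x \<nu> + (1 - t) *\<^sub>R w) \<le> 0"
      using diag[OF \<nu> xX] by (simp add: u_def)
    with pos show False
      by simp
  qed
  then show ?thesis
    using x feasible unfolding equilibria_def by blast
qed

end
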